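(* Let $w_{1},w_{2},w_{3}$ be any odd positive integers and $n\ge0$ an integer. Then \begin{align*} &\sum_{k+l+m=n}\binom{n}{k,l,m}T_{k}(w_{1}-1)T_{l}(w_{2}-1)T_{m}(w_{3}-1)w_{3}^{k}w_{1}^{l}w_{2}^{m}\\ =&\sum_{k+l+m=n}\binom{n}{k,l,m}T_{k}(w_{1}-1)T_{l}(w_{3}-1)T_{m}(w_{2}-1)w_{2}^{k}w_{1}^{l}w_{3}^{m}. \end{align*}
   Context: For integers $k,N\ge0$, $T_{k}(N)=\sum_{i=0}^{N}(-1)^{i}i^{k}$, with the convention $0^0=1$. Sums $\sum_{k+l+m=n}$ run over all nonnegative integers $k,l,m$ with $k+l+m=n$, and $\binom{n}{k,l,m}=\frac{n!}{k!\,l!\,m!}$. *)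

theory Defs
  imports Complex_Main
begin

text \<open>Note that \<open>0 ^ 0 = 1\<close> in HOL, so that the summand for \<open>i = 0\<close> is \<open>1\<close> when \<open>k = 0\<close>.\<close>

definition T :: "nat \<Rightarrow> nat \<Rightarrow> int" where
  "T k N = (\<Sum>i=0..N. (-1) ^ i * int i ^ k)"

text \<open>The quotient is exact whenever \<open>n = k + l + m\<close>; see \<open>of_nat_trinomial\<close> below.\<close>

definition trinomial :: "nat \<Rightarrow> nat \<Rightarrow> nat \<Rightarrow> nat \<Rightarrow> nat" where
  "trinomial n k l m = fact n div (fact k * fact l * fact m)"

definition weak_compositions3 :: "nat \<Rightarrow> (nat \<times> nat \<times> nat) set" where
  "weak_compositions3 n = {(k, l, m). k + l + m = n}"

lemma of_nat_trinomial:
  assumes "k + l + m = n"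
  shows "real (trinomial n k l m) = fact n / (fact k * fact l * fact m)"
proof -
  have "(fact k * fact l * fact m :: nat) dvd fact (k + l) * fact m"
    by (intro mult_dvd_mono fact_fact_dvd_fact dvd_refl)
  also have "\<dots> dvd fact (k + l + m)"
    by (rule fact_fact_dvd_fact)
  finally show ?thesis
    using assms by (simp add: trinomial_def real_of_nat_div)
qed

lemma finite_weak_compositions3: "finite (weak_compositions3 n)"
  by (rule finite_subset[of _ "{..n} \<times> {..n} \<times> {..n}"]) (auto simp: weak_compositions3_def)

end

theory Submission
  imports Defs "HOL-Computational_Algebra.Formal_Power_Series"
begin

unbundle fps_syntax

text \<open>
  The factor \<open>\<Sum>k. T k (N - 1) * w ^ k * X ^ k / k!\<close> is the alternating sum
  \<open>\<Sum>i<N. (-1) ^ i * exp (i * w * X)\<close>, which for odd \<open>N\<close> is the quotient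
  \<open>(1 + exp (N * w * X)) / (1 + exp (w * X))\<close>.  Hence both sides of the identity are
  \<open>n!\<close> times the \<open>n\<close>-th coefficient of the power series
  \<open>(1 + exp (w1 * w2 * X)) * (1 + exp (w1 * w3 * X)) * (1 + exp (w2 * w3 * X)) /
    ((1 + exp (w1 * X)) * (1 + exp (w2 * X)) * (1 + exp (w3 * X)))\<close>,
  which is symmetric in \<open>w1\<close>, \<open>w2\<close>, \<open>w3\<close>.
\<close>

definition alternating_exp_sum :: "nat \<Rightarrow> nat \<Rightarrow> real fps" where
  "alternating_exp_sum N w = (\<Sum>i<N. (-1) ^ i * fps_exp (of_nat (i * w)))"

text \<open>Geometric sum with ratio -exp(w X), kept free of division. For odd \<open>N\<close> the
  right-hand side becomes 1 + exp(N w X).\<close>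

lemma alternating_exp_sum_telescope:
  "alternating_exp_sum N w * (1 + fps_exp (of_nat w)) = 1 - (-1) ^ N * fps_exp (of_nat (N * w))"
proof (induction N)
  case 0
  then show ?case by (simp add: alternating_exp_sum_def)
next
  case (Suc N)
  have exp_Suc: "(fps_exp (of_nat (Suc N * w)) :: real fps)
      = fps_exp (of_nat (N * w)) * fps_exp (of_nat w)"
    by (simp add: fps_exp_add_mult[symmetric] algebra_simps)
  have "alternating_exp_sum (Suc N) w * (1 + fps_exp (of_nat w))
      = alternating_exp_sum N w * (1 + fps_exp (of_nat w))
        + (-1) ^ N * fps_exp (of_nat (N * w)) * (1 + fps_exp (of_nat w))"
    by (simp add: alternating_exp_sum_def distrib_right)
  also have "\<dots> = 1 - (-1) ^ Suc N * fps_exp (of_nat (Suc N * w))"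
    unfolding Suc.IH exp_Suc by (simp add: algebra_simps)
  finally show ?case .
qed

lemma alternating_exp_sum_nth:
  assumes "N > 0"
  shows "alternating_exp_sum N w $ k = of_int (T k (N - 1)) * of_nat w ^ k / fact k"
proof -
  \<comment> \<open>At \<open>N = 0\<close> truncated subtraction would leave the index 0 on the
    left.\<close>
  have "{0..N - 1} = {..<N}"
    using assms by auto
  \<comment> \<open>The sign on the left is a power series; the parity split reduces it to 1 or
    -1.\<close>
  moreover have "((-1) ^ i * fps_exp c) $ k = (-1) ^ i * c ^ k / fact k" for i and c :: real
    by (cases "even i") auto
  ultimately show ?thesis
    by (simp add: alternating_exp_sum_def fps_sum_nth T_def sum_distrib_right
        sum_divide_distrib power_mult_distrib mult.assoc)
qed

text \<open>Two nested Cauchy products: \<open>k\<close> and \<open>l\<close> determine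
  \<open>m = n - k - l\<close>.\<close>

lemma fps_mult3_nth:
  fixes f g h :: "'a::comm_semiring_1 fps"
  shows "(f * g * h) $ n = (\<Sum>(k, l, m) \<in> weak_compositions3 n. f $ k * g $ l * h $ m)"
proof -
  have "(f * g * h) $ n = (\<Sum>k=0..n. \<Sum>l=0..n - k. f $ k * g $ l * h $ (n - k - l))"
    by (simp add: mult.assoc fps_mult_nth sum_distrib_left)
  also have "\<dots> = (\<Sum>(k, l)\<in>Sigma {0..n} (\<lambda>k. {0..n - k}). f $ k * g $ l * h $ (n - k - l))"
    by (simp add: sum.Sigma)
  also have "\<dots> = (\<Sum>(k, l, m) \<in> weak_compositions3 n. f $ k * g $ l * h $ m)"
    by (rule sum.reindex_bij_witness[of _ "\<lambda>(k, l, m). (k, l)" "\<lambda>(k, l). (k, l, n - k - l)"])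
      (auto simp: weak_compositions3_def)
  finally show ?thesis .
qed

text \<open>The exponential coefficients supply 1/(k! l! m!), which n! completes to the trinomial.
  The six parameters are left free so that both sides of the theorem are instances.\<close>

lemma trinomial_T_sum_eq_nth:
  assumes "a > 0" and "b > 0" and "c > 0"
  shows "real_of_int (\<Sum>(k, l, m) \<in> weak_compositions3 n.
        int (trinomial n k l m) * T k (a - 1) * T l (b - 1) * T m (c - 1)
          * int x ^ k * int y ^ l * int z ^ m)
   = fact n * (alternating_exp_sum a x * alternating_exp_sum b y * alternating_exp_sum c z) $ n"
  unfolding fps_mult3_nth of_int_sum sum_distrib_left
proof (rule sum.cong[OF refl], clarify)
  fix k l m assume "(k, l, m) \<in> weak_compositions3 n"
  then have "real (trinomial n k l m) = fact n / (fact k * fact l * fact m)"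
    by (simp add: weak_compositions3_def of_nat_trinomial)
  then show "real_of_int (int (trinomial n k l m) * T k (a - 1) * T l (b - 1) * T m (c - 1)
          * int x ^ k * int y ^ l * int z ^ m)
      = fact n * (alternating_exp_sum a x $ k * alternating_exp_sum b y $ l
          * alternating_exp_sum c z $ m)"
    using assms by (simp add: alternating_exp_sum_nth)
qed

lemma alternating_exp_sum_prod_swap:
  assumes "odd w1" and "odd w2" and "odd w3"
  shows "alternating_exp_sum w1 w3 * alternating_exp_sum w2 w1 * alternating_exp_sum w3 w2
       = alternating_exp_sum w1 w2 * alternating_exp_sum w3 w1 * alternating_exp_sum w2 w3"
    (is "?L = ?R")
proof -
  define D :: "nat \<Rightarrow> real fps" where "D w = 1 + fps_exp (of_nat w)" for w
  have D_nonzero: "D w \<noteq> 0" for w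
  proof
    assume "D w = 0"
    then have "D w $ 0 = 0" by simp
    \<comment> \<open>The constant coefficient of \<open>D w\<close> is 2.\<close>
    then show False by (simp add: D_def)
  qed
  have quotient: "alternating_exp_sum N w * D w = D (N * w)" if "odd N" for N w
    using alternating_exp_sum_telescope[of N w] that by (simp add: D_def)
  have "?L * (D w1 * D w2 * D w3)
      = (alternating_exp_sum w1 w3 * D w3) * (alternating_exp_sum w2 w1 * D w1)
        * (alternating_exp_sum w3 w2 * D w2)"
    by (simp only: mult_ac)
  also have "\<dots> = (alternating_exp_sum w1 w2 * D w2) * (alternating_exp_sum w3 w1 * D w1)
        * (alternating_exp_sum w2 w3 * D w3)"
    \<comment> \<open>Both sides are now products of \<open>D\<close> at the three pairwise products
      of the weights, up to commutativity inside and outside \<open>D\<close>.\<close>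
    unfolding assms[THEN quotient] by (simp only: mult_ac)
  also have "\<dots> = ?R * (D w1 * D w2 * D w3)"
    by (simp only: mult_ac)
  \<comment> \<open>Real power series form an integral domain, so the common denominator
    cancels.\<close>
  finally show ?thesis
    using D_nonzero by simp
qed

theorem theorem17:
  fixes w1 w2 w3 n :: nat
  assumes "odd w1" and "odd w2" and "odd w3"
    and "w1 > 0" and "w2 > 0" and "w3 > 0"
  shows
    "(\<Sum>(k, l, m) \<in> weak_compositions3 n.
        int (trinomial n k l m) * T k (w1 - 1) * T l (w2 - 1) * T m (w3 - 1)
          * int w3 ^ k * int w1 ^ l * int w2 ^ m)
   = (\<Sum>(k, l, m) \<in> weak_compositions3 n.
        int (trinomial n k l m) * T k (w1 - 1) * T l (w3 - 1) * T m (w2 - 1)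
          * int w2 ^ k * int w1 ^ l * int w3 ^ m)" (is "?L = ?R")
proof -
  have "real_of_int ?L = real_of_int ?R"
    unfolding trinomial_T_sum_eq_nth[OF assms(4,5,6)] trinomial_T_sum_eq_nth[OF assms(4,6,5)]
      alternating_exp_sum_prod_swap[OF assms(1-3)] ..
  then show ?thesis
    by (simp only: of_int_eq_iff)
qed

end
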